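(* The conical ideal MHD system on the unit sphere is of mixed type: with $\xi^1$ treated as the time-like variable, it can be either hyperbolic or elliptic depending on the solution. Precisely, write the system in quasilinear form $C^1\Phi_{\xi^1}+C^2\Phi_{\xi^2}+S^*=0$ with $\Phi=(\rho,v^1,v^2,V^3,P,b^1,b^2,B^3)^T$ and the matrices $C^1,C^2$ given in the context, and let the gas law, the constant $\mu>0$ and the metric $(g_{\alpha\beta})$ at a point be given. Then there exist state values with $C^1$ invertible for which all eight eigenvalues of $\bar C=(C^1)^{-1}C^2$ are real (the system is hyperbolic there), and there exist state values with $C^1$ invertible for which $\bar C$ has non-real eigenvalues (the system is elliptic there).
   Context: Here superscripts on $v,b$ are indices, not powers. $(g_{\alpha\beta})$, $\alpha,\beta\in\{1,2\}$, is the (symmetric positive definite) metric of the unit sphere in coordinates $(\xi^1,\xi^2)$, with inverse $(g^{\alpha\beta})$. The state variables are the density $\rho>0$, rescaled surface velocity components $v^1,v^2$, radial velocity $V^3$, pressure $P$, rescaled surface magnetic field components $b^1,b^2$, and radial magnetic field $B^3$, all real; $\mu>0$ is the permeability constant. Write $b_\alpha=g_{\alpha\beta}b^\beta$ (summed over $\beta$). The speed of sound $c$ is $c=\sqrt{PP_e+\rho^2P_\rho}/\rho$, where $P=P(\rho,e)$ is the gas law in terms of density and specific thermal energy $e$ and subscripts denote partial derivatives; the gas law is such that $c$ is real and positive on the (nonempty) set of admissible $(\rho,e)$ with $\rho>0$. Type: for a system $\Phi_{\xi^1}+\bar C\,\Phi_{\xi^2}+\bar S=0$ with $\xi^1$ time-like,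 the system is called hyperbolic (strictly if the eigenvalues of $\bar C$ are real and distinct, non-strictly if they are all real but not all distinct), and it is called elliptic if any of the eigenvalues of $\bar C$ is complex (non-real). The system is the one obtained from the steady 3D ideal MHD equations with Powell source terms for conically invariant fields. In the variables $\Phi$ its matrices are $$C^1=\begin{pmatrix} v^1&\rho&0&0&0&0&0&0\\ 0&v^1&0&0&g^{11}/\rho&-g^{12}b_2/(\mu\rho)&g^{11}b_2/(\mu\rho)&g^{11}B^3/(\mu\rho)\\ 0&0&v^1&0&g^{12}/\rho&g^{12}b_1/(\mu\rho)&-g^{11}b_1/(\mu\rho)&g^{12}B^3/(\mu\rho)\\ 0&0&0&v^1&0&0&0&-b^1/(\mu\rho)\\ 0&c^2\rho&0&0&v^1&0&0&0\\ 0&0&0&0&0&v^1&0&0\\ 0&b^2&-b^1&0&0&0&v^1&0\\ 0&B^3&0&-b^1&0&0&0&v^1\end{pmatrix},$$ $$C^2=\begin{pmatrix} v^2&0&\rho&0&0&0&0&0\\ 0&v^2&0&0&g^{21}/\rho&-g^{22}b_2/(\mu\rho)&g^{12}b_2/(\mu\rho)&g^{21}B^3/(\mu\rho)\\ 0&0&v^2&0&g^{22}/\rho&g^{22}b_1/(\mu\rho)&-g^{12}b_1/(\mu\rho)&g^{22}B^3/(\mu\rho)\\ 0&0&0&v^2&0&0&0&-b^2/(\mu\rho)\\ 0&0&c^2\rho&0&v^2&0&0&0\\ 0&-b^2&b^1&0&0&v^2&0&0\\ 0&0&0&0&0&0&v^2&0\\ 0&0&B^3&-b^2&0&0&0&v^2\end{pmatrix}.$$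 *)

theory Defs
  imports
    "HOL-Analysis.Derivative"
    "Jordan_Normal_Form.Gauss_Jordan_Elimination"
    "Jordan_Normal_Form.Spectral_Radius"
begin

text \<open>
  A gas law is a function \<open>p\<close> of density and specific thermal energy, with a set \<open>D\<close> of
  admissible pairs. As \<open>sqrt\<close> is total on the reals, reality of the speed of sound is the
  nonnegativity of its radicand. Only the partial derivatives at points of \<open>D\<close> are used.
\<close>

definition sound_radicand :: "(real \<Rightarrow> real \<Rightarrow> real) \<Rightarrow> real \<Rightarrow> real \<Rightarrow> real" where
  "sound_radicand p \<rho> e = p \<rho> e * deriv (\<lambda>e'. p \<rho> e') e + \<rho>\<^sup>2 * deriv (\<lambda>\<rho>'. p \<rho>' e) \<rho>"

definition sound_speed :: "(real \<Rightarrow> real \<Rightarrow> real) \<Rightarrow> real \<Rightarrow> real \<Rightarrow> real" where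
  "sound_speed p \<rho> e = sqrt (sound_radicand p \<rho> e) / \<rho>"

definition gas_law :: "(real \<times> real) set \<Rightarrow> (real \<Rightarrow> real \<Rightarrow> real) \<Rightarrow> bool" where
  "gas_law D p \<longleftrightarrow> D \<noteq> {} \<and>
     (\<forall>(\<rho>, e) \<in> D. \<rho> > 0 \<and>
        (\<lambda>\<rho>'. p \<rho>' e) differentiable (at \<rho>) \<and>
        (\<lambda>e'. p \<rho> e') differentiable (at e) \<and>
        sound_radicand p \<rho> e \<ge> 0 \<and> sound_speed p \<rho> e > 0)"

definition surface_metric :: "real mat \<Rightarrow> bool" where
  "surface_metric g \<longleftrightarrow> g \<in> carrier_mat 2 2 \<and> transpose_mat g = g \<and>
     (\<forall>x \<in> carrier_vec 2. x \<noteq> 0\<^sub>v 2 \<longrightarrow> scalar_prod x (g *\<^sub>v x) > 0)"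

text \<open>
  Tensor indices run over 1 and 2, matrix indices start at 0.
\<close>

definition metric_lower :: "real mat \<Rightarrow> nat \<Rightarrow> nat \<Rightarrow> real" where
  "metric_lower g \<alpha> \<beta> = g $$ (\<alpha> - 1, \<beta> - 1)"

definition metric_upper :: "real mat \<Rightarrow> nat \<Rightarrow> nat \<Rightarrow> real" where
  "metric_upper g \<alpha> \<beta> = the (mat_inverse g) $$ (\<alpha> - 1, \<beta> - 1)"

text \<open>
  The state \<open>\<Phi> = (\<rho>, v\<^sup>1, v\<^sup>2, V\<^sup>3, P, b\<^sup>1, b\<^sup>2, B\<^sup>3)\<close>, with contravariant
  surface components.
\<close>

record mhd_state =
  density :: real
  vel1 :: real
  vel2 :: real
  radial_vel :: real
  pressure :: real
  mag1 :: real
  mag2 :: real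
  radial_mag :: real

text \<open>
  The speed of sound is a function of density and thermal energy, so a state is accompanied
  by an admissible \<open>e\<close> that produces its pressure.
\<close>

definition state_with_energy ::
  "(real \<times> real) set \<Rightarrow> (real \<Rightarrow> real \<Rightarrow> real) \<Rightarrow> mhd_state \<Rightarrow> real \<Rightarrow> bool" where
  "state_with_energy D p \<Phi> e \<longleftrightarrow>
     (density \<Phi>, e) \<in> D \<and> pressure \<Phi> = p (density \<Phi>) e"

definition mag_lower :: "real mat \<Rightarrow> mhd_state \<Rightarrow> nat \<Rightarrow> real" where
  "mag_lower g \<Phi> \<alpha> = metric_lower g \<alpha> 1 * mag1 \<Phi> + metric_lower g \<alpha> 2 * mag2 \<Phi>"

definition C1 :: "real mat \<Rightarrow> real \<Rightarrow> real \<Rightarrow> mhd_state \<Rightarrow> real mat" where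
  "C1 g \<mu> c \<Phi> =
    (let \<rho> = density \<Phi>; v = vel1 \<Phi>; b1 = mag1 \<Phi>; b2 = mag2 \<Phi>; B = radial_mag \<Phi>;
         bl = mag_lower g \<Phi>; G = metric_upper g
     in mat_of_rows_list 8
      [[v, \<rho>,       0,   0,   0,         0,                         0,                         0],
       [0, v,       0,   0,   G 1 1 / \<rho>, - G 1 2 * bl 2 / (\<mu> * \<rho>), G 1 1 * bl 2 / (\<mu> * \<rho>),   G 1 1 * B / (\<mu> * \<rho>)],
       [0, 0,       v,   0,   G 1 2 / \<rho>, G 1 2 * bl 1 / (\<mu> * \<rho>),   - G 1 1 * bl 1 / (\<mu> * \<rho>), G 1 2 * B / (\<mu> * \<rho>)],
       [0, 0,       0,   v,   0,         0,                         0,                         - b1 / (\<mu> * \<rho>)],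
       [0, c\<^sup>2 * \<rho>, 0,   0,   v,         0,                         0,                         0],
       [0, 0,       0,   0,   0,         v,                         0,                         0],
       [0, b2,      -b1, 0,   0,         0,                         v,                         0],
       [0, B,       0,   -b1, 0,         0,                         0,                         v]])"

definition C2 :: "real mat \<Rightarrow> real \<Rightarrow> real \<Rightarrow> mhd_state \<Rightarrow> real mat" where
  "C2 g \<mu> c \<Phi> =
    (let \<rho> = density \<Phi>; v = vel2 \<Phi>; b1 = mag1 \<Phi>; b2 = mag2 \<Phi>; B = radial_mag \<Phi>;
         bl = mag_lower g \<Phi>; G = metric_upper g
     in mat_of_rows_list 8
      [[v, 0,   \<rho>,       0,   0,         0,                         0,                         0],
       [0, v,   0,       0,   G 2 1 / \<rho>, - G 2 2 * bl 2 / (\<mu> * \<rho>), G 1 2 * bl 2 / (\<mu> * \<rho>),   G 2 1 * B / (\<mu> * \<rho>)],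
       [0, 0,   v,       0,   G 2 2 / \<rho>, G 2 2 * bl 1 / (\<mu> * \<rho>),   - G 1 2 * bl 1 / (\<mu> * \<rho>), G 2 2 * B / (\<mu> * \<rho>)],
       [0, 0,   0,       v,   0,         0,                         0,                         - b2 / (\<mu> * \<rho>)],
       [0, 0,   c\<^sup>2 * \<rho>, 0,   v,         0,                         0,                         0],
       [0, -b2, b1,      0,   0,         v,                         0,                         0],
       [0, 0,   0,       0,   0,         0,                         v,                         0],
       [0, 0,   B,       -b2, 0,         0,                         0,                         v]])"

definition Cbar :: "real mat \<Rightarrow> real \<Rightarrow> real \<Rightarrow> mhd_state \<Rightarrow> real mat" where
  "Cbar g \<mu> c \<Phi> = the (mat_inverse (C1 g \<mu> c \<Phi>)) * C2 g \<mu> c \<Phi>"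

text \<open>
  Type of a system \<open>\<Phi>\<^sub>\<xi>\<^sub>1 + M \<Phi>\<^sub>\<xi>\<^sub>2 + S = 0\<close>. The eigenvalues are those over the complex
  numbers. Hyperbolicity includes the strict and the non-strict case, so no
  diagonalizability is required.
\<close>

definition hyperbolic_type :: "real mat \<Rightarrow> bool" where
  "hyperbolic_type M \<longleftrightarrow> (\<forall>\<kappa> \<in> spectrum (map_mat complex_of_real M). \<kappa> \<in> \<real>)"

definition elliptic_type :: "real mat \<Rightarrow> bool" where
  "elliptic_type M \<longleftrightarrow> (\<exists>\<kappa> \<in> spectrum (map_mat complex_of_real M). \<kappa> \<notin> \<real>)"

end

(*
  With no magnetic field and second surface velocity component zero the system is that of a conical gas flow. The nonzero
  eigenvalues are then governed by a real quadratic whose quarter discriminant is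
  c^2 (g^22 (v^1)^2 - c^2 det(g^ab)), so that fast flows are hyperbolic and slow
  ones elliptic.
*)
theory Submission
  imports Defs
begin

unbundle no vec_syntax

section \<open>Inverses of matrices with trivial kernel\<close>

text \<open>A trivial kernel makes the determinant nonzero, so \<open>mat_inverse\<close> returns a
  value and \<open>the\<close> is meaningful. The kernel condition is easier to check for the sparse
  8 by 8 matrices than a determinant.\<close>

lemma mat_inverse_nonsingular:
  fixes A :: "'a :: field mat"
  assumes A: "A \<in> carrier_mat n n"
    and ker: "\<And>x. x \<in> carrier_vec n \<Longrightarrow> A *\<^sub>v x = 0\<^sub>v n \<Longrightarrow> x = 0\<^sub>v n"
  shows "the (mat_inverse A) \<in> carrier_mat n n"
    and "A * the (mat_inverse A) = 1\<^sub>m n"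
    and "the (mat_inverse A) * A = 1\<^sub>m n"
proof -
  have "det A \<noteq> 0"
    using det_0_iff_vec_prod_zero[OF A] ker by blast
  then have "mat_inverse A \<noteq> None"
    using det_non_zero_imp_unit[OF A, of "()"] mat_inverse(1)[OF A, of "()"] by blast
  then show "the (mat_inverse A) \<in> carrier_mat n n"
    and "A * the (mat_inverse A) = 1\<^sub>m n"
    and "the (mat_inverse A) * A = 1\<^sub>m n"
    using mat_inverse(2)[OF A] by auto
qed

lemma invertible_mat_kernel:
  fixes A :: "'a :: field mat"
  assumes A: "A \<in> carrier_mat n n"
    and ker: "\<And>x. x \<in> carrier_vec n \<Longrightarrow> A *\<^sub>v x = 0\<^sub>v n \<Longrightarrow> x = 0\<^sub>v n"
  shows "invertible_mat A"
proof -
  note inv = mat_inverse_nonsingular[OF A ker]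
  have "inverts_mat A (the (mat_inverse A))" "inverts_mat (the (mat_inverse A)) A"
    using A inv by (auto simp: inverts_mat_def)
  then show ?thesis using A by (auto simp: invertible_mat_def)
qed

section \<open>Positivity of the contravariant metric\<close>

text \<open>Transposing \<open>g * h = 1\<close> shows that the transpose of \<open>h\<close> is
  also a left inverse of \<open>g\<close>, which gives symmetry. Positivity follows by substituting
  \<open>y = g x\<close>, since the form of \<open>h\<close> at \<open>y\<close> is the form of
  \<open>g\<close> at \<open>x\<close>.\<close>

lemma surface_metric_inverse:
  assumes g: "surface_metric g"
  shows "surface_metric (the (mat_inverse g))"
proof -
  define h where "h = the (mat_inverse g)"
  have gc: "g \<in> carrier_mat 2 2" and gt: "transpose_mat g = g"
    and pos: "\<And>x. x \<in> carrier_vec 2 \<Longrightarrow> x \<noteq> 0\<^sub>v 2 \<Longrightarrow> scalar_prod x (g *\<^sub>v x) > 0"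
    using g by (auto simp: surface_metric_def)
  have ker: "x = 0\<^sub>v 2" if "x \<in> carrier_vec 2" "g *\<^sub>v x = 0\<^sub>v 2" for x
    using pos[of x] that by fastforce
  note inv = mat_inverse_nonsingular[OF gc ker, folded h_def]
  have hc: "h \<in> carrier_mat 2 2" and gh: "g * h = 1\<^sub>m 2" and hg: "h * g = 1\<^sub>m 2"
    using inv by blast+
  have "transpose_mat h * g = 1\<^sub>m 2"
    using transpose_mult[OF gc hc] gt gh by simp
  then have "transpose_mat h * (g * h) = h"
    using hc gc by (metis assoc_mult_mat left_mult_one_mat transpose_carrier_mat)
  then have ht: "transpose_mat h = h"
    using gh hc by simp
  have "scalar_prod y (h *\<^sub>v y) > 0" if y: "y \<in> carrier_vec 2" "y \<noteq> 0\<^sub>v 2" for y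
  proof -
    have hy: "h *\<^sub>v y \<in> carrier_vec 2" using hc y by simp
    have ghy: "g *\<^sub>v (h *\<^sub>v y) = y"
      using assoc_mult_mat_vec[OF gc hc y(1)] gh y by simp
    have "g *\<^sub>v 0\<^sub>v 2 = 0\<^sub>v 2" using gc by (intro eq_vecI) auto
    then have "h *\<^sub>v y \<noteq> 0\<^sub>v 2" using ghy y(2) by metis
    then have "scalar_prod (h *\<^sub>v y) y > 0" using pos[OF hy] ghy by simp
    then show ?thesis using comm_scalar_prod[OF hy y(1)] by simp
  qed
  then show ?thesis using hc ht by (simp add: surface_metric_def h_def)
qed

lemma surface_metric_entries:
  assumes "surface_metric h"
  shows "h $$ (1, 0) = h $$ (0, 1)" and "h $$ (0, 0) > 0" and "h $$ (1, 1) > 0"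
    and "(h $$ (0, 1))\<^sup>2 < h $$ (0, 0) * h $$ (1, 1)"
proof -
  have hc: "h \<in> carrier_mat 2 2" and ht: "transpose_mat h = h"
    and pos: "\<And>x. x \<in> carrier_vec 2 \<Longrightarrow> x \<noteq> 0\<^sub>v 2 \<Longrightarrow> scalar_prod x (h *\<^sub>v x) > 0"
    using assms by (auto simp: surface_metric_def)
  show sym: "h $$ (1, 0) = h $$ (0, 1)"
    using arg_cong[OF ht, of "\<lambda>m. m $$ (0, 1)"] hc by simp
  have form: "s * (h $$ (0, 0) * s + h $$ (0, 1) * t) + t * (h $$ (1, 0) * s + h $$ (1, 1) * t) > 0"
    if "s \<noteq> 0 \<or> t \<noteq> 0" for s t :: real
  proof -
    define x where "x = Matrix.vec 2 (\<lambda>i. if i = 0 then s else t)"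
    have x: "x \<in> carrier_vec 2" "x $ 0 = s" "x $ 1 = t" by (auto simp: x_def)
    then have "x \<noteq> 0\<^sub>v 2" using that by auto
    from pos[OF x(1) this] show ?thesis
      using hc x by (simp add: scalar_prod_def numeral_2_eq_2)
  qed
  show p: "h $$ (0, 0) > 0" using form[of 1 0] by simp
  show "h $$ (1, 1) > 0" using form[of 0 1] by simp
  \<comment> \<open>At this test vector the quadratic form equals \<open>h $$ (0, 0)\<close> times
    the determinant.\<close>
  have "h $$ (0, 0) * (h $$ (0, 0) * h $$ (1, 1) - (h $$ (0, 1))\<^sup>2) > 0"
    using form[of "- h $$ (0, 1)" "h $$ (0, 0)"] p sym
    by (simp add: algebra_simps power2_eq_square)
  then show "(h $$ (0, 1))\<^sup>2 < h $$ (0, 0) * h $$ (1, 1)"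
    using p by (simp add: zero_less_mult_iff)
qed

section \<open>Eigenvalues as a matrix pencil problem\<close>

text \<open>Multiplying the eigenvalue equation by \<open>A\<close> or by its inverse passes between
  the two forms. The entries of the inverse of \<open>C1\<close> thus never have to be
  computed.\<close>

lemma spectrum_pencil_iff:
  fixes A B :: "real mat"
  assumes A: "A \<in> carrier_mat n n" and B: "B \<in> carrier_mat n n"
    and ker: "\<And>x. x \<in> carrier_vec n \<Longrightarrow> A *\<^sub>v x = 0\<^sub>v n \<Longrightarrow> x = 0\<^sub>v n"
  shows "\<kappa> \<in> spectrum (map_mat complex_of_real (the (mat_inverse A) * B)) \<longleftrightarrow>
    (\<exists>x \<in> carrier_vec n. x \<noteq> 0\<^sub>v n \<and>
       map_mat of_real B *\<^sub>v x = \<kappa> \<cdot>\<^sub>v (map_mat of_real A *\<^sub>v x))"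
proof -
  define h where "h = map_mat complex_of_real (the (mat_inverse A))"
  define a where "a = map_mat complex_of_real A"
  define b where "b = map_mat complex_of_real B"
  note inv = mat_inverse_nonsingular[OF A ker]
  have hc: "h \<in> carrier_mat n n" and ac: "a \<in> carrier_mat n n" and bc: "b \<in> carrier_mat n n"
    using inv(1) A B by (auto simp: h_def a_def b_def)
  have ah: "a * h = 1\<^sub>m n" and ha: "h * a = 1\<^sub>m n"
    unfolding a_def h_def
    using inv A by (simp_all add: of_real_hom.mat_hom_mult[symmetric] of_real_hom.mat_hom_one)
  have hb: "map_mat complex_of_real (the (mat_inverse A) * B) = h * b"
    unfolding h_def b_def using inv(1) B by (rule of_real_hom.mat_hom_mult)
  have ev: "\<kappa> \<in> spectrum (h * b) \<longleftrightarrow>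
      (\<exists>x. x \<in> carrier_vec n \<and> x \<noteq> 0\<^sub>v n \<and> h * b *\<^sub>v x = \<kappa> \<cdot>\<^sub>v x)"
    unfolding spectrum_def eigenvalue_def eigenvector_def using hc by simp
  have "h * b *\<^sub>v x = \<kappa> \<cdot>\<^sub>v x \<longleftrightarrow> b *\<^sub>v x = \<kappa> \<cdot>\<^sub>v (a *\<^sub>v x)" if x: "x \<in> carrier_vec n" for x
  proof -
    have bx: "b *\<^sub>v x \<in> carrier_vec n" and ax: "a *\<^sub>v x \<in> carrier_vec n"
      using ac bc x by auto
    have 1: "a *\<^sub>v (h *\<^sub>v (b *\<^sub>v x)) = b *\<^sub>v x"
      using assoc_mult_mat_vec[OF ac hc bx] ah bx by simp
    have 2: "h *\<^sub>v (a *\<^sub>v x) = x"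
      using assoc_mult_mat_vec[OF hc ac x] ha x by simp
    have "b *\<^sub>v x = \<kappa> \<cdot>\<^sub>v (a *\<^sub>v x)" if "h *\<^sub>v (b *\<^sub>v x) = \<kappa> \<cdot>\<^sub>v x"
      using 1 mult_mat_vec[OF ac x, of \<kappa>] that by simp
    moreover have "h *\<^sub>v (b *\<^sub>v x) = \<kappa> \<cdot>\<^sub>v x" if "b *\<^sub>v x = \<kappa> \<cdot>\<^sub>v (a *\<^sub>v x)"
      using 2 mult_mat_vec[OF hc ax, of \<kappa>] that by simp
    ultimately show ?thesis
      unfolding assoc_mult_mat_vec[OF hc bc x] by blast
  qed
  then show ?thesis
    unfolding hb ev a_def[symmetric] b_def[symmetric] by blast
qed

section \<open>The system at states without magnetic field\<close>

text \<open>The zero second surface velocity clears the diagonal of \<open>C2\<close>. The pressure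
  remains a parameter so that it can be matched to the gas law.\<close>

definition unmagnetized :: "real \<Rightarrow> real \<Rightarrow> real \<Rightarrow> mhd_state" where
  "unmagnetized \<rho> P v = \<lparr>density = \<rho>, vel1 = v, vel2 = 0, radial_vel = 0, pressure = P,
     mag1 = 0, mag2 = 0, radial_mag = 0\<rparr>"

lemma C1_carrier: "C1 g \<mu> c \<Phi> \<in> carrier_mat 8 8"
  by (rule carrier_matI) (simp_all add: C1_def Let_def mat_of_rows_list_def)

lemma C2_carrier: "C2 g \<mu> c \<Phi> \<in> carrier_mat 8 8"
  by (rule carrier_matI) (simp_all add: C2_def Let_def mat_of_rows_list_def)

lemma all_less_8: "(\<forall>i<8. Q i) \<longleftrightarrow>
    Q 0 \<and> Q (Suc 0) \<and> Q 2 \<and> Q 3 \<and> Q 4 \<and> Q 5 \<and> Q 6 \<and> Q (7::nat)"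
  by (simp add: numeral_eq_Suc All_less_Suc conj_ac)

lemma sum_less_8: "(\<Sum>i\<in>{0..<8::nat}. f i) =
    f 0 + f (Suc 0) + f 2 + f 3 + f 4 + f 5 + f 6 + (f 7 :: 'a :: comm_monoid_add)"
  by (simp add: numeral_eq_Suc)

text \<open>Stated over any \<open>real_field\<close>: the real instance serves the kernel of
  \<open>C1\<close>, the complex one the eigenvectors.\<close>

lemma C1_unmagnetized_mult:
  fixes x :: "'a :: real_field vec"
  assumes "x \<in> carrier_vec 8"
    and y: "y = map_mat of_real (C1 g \<mu> c (unmagnetized \<rho> P v)) *\<^sub>v x"
  shows "y \<in> carrier_vec 8"
    and "y $ 0 = of_real v * x $ 0 + of_real \<rho> * x $ 1"
    and "y $ 1 = of_real v * x $ 1 + of_real (metric_upper g 1 1 / \<rho>) * x $ 4"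
    and "y $ 2 = of_real v * x $ 2 + of_real (metric_upper g 1 2 / \<rho>) * x $ 4"
    and "y $ 3 = of_real v * x $ 3"
    and "y $ 4 = of_real (c\<^sup>2 * \<rho>) * x $ 1 + of_real v * x $ 4"
    and "y $ 5 = of_real v * x $ 5"
    and "y $ 6 = of_real v * x $ 6"
    and "y $ 7 = of_real v * x $ 7"
proof -
  show "y \<in> carrier_vec 8"
    unfolding y using C1_carrier assms(1) by (metis map_carrier_mat mult_mat_vec_carrier)
qed (use assms(1) in \<open>simp_all add: y C1_def Let_def unmagnetized_def mag_lower_def
      mat_of_rows_list_def scalar_prod_def sum_less_8\<close>)

lemma C2_unmagnetized_mult:
  fixes x :: "'a :: real_field vec"
  assumes "x \<in> carrier_vec 8"
    and y: "y = map_mat of_real (C2 g \<mu> c (unmagnetized \<rho> P v)) *\<^sub>v x"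
  shows "y \<in> carrier_vec 8"
    and "y $ 0 = of_real \<rho> * x $ 2"
    and "y $ 1 = of_real (metric_upper g 2 1 / \<rho>) * x $ 4"
    and "y $ 2 = of_real (metric_upper g 2 2 / \<rho>) * x $ 4"
    and "y $ 3 = 0"
    and "y $ 4 = of_real (c\<^sup>2 * \<rho>) * x $ 2"
    and "y $ 5 = 0"
    and "y $ 6 = 0"
    and "y $ 7 = 0"
proof -
  show "y \<in> carrier_vec 8"
    unfolding y using C2_carrier assms(1) by (metis map_carrier_mat mult_mat_vec_carrier)
qed (use assms(1) in \<open>simp_all add: y C2_def Let_def unmagnetized_def mag_lower_def
      mat_of_rows_list_def scalar_prod_def sum_less_8\<close>)

lemma eq_vec_8_iff:
  assumes "x \<in> carrier_vec 8" and "y \<in> carrier_vec 8"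
  shows "x = y \<longleftrightarrow> x $ 0 = y $ 0 \<and> x $ 1 = y $ 1 \<and> x $ 2 = y $ 2 \<and> x $ 3 = y $ 3 \<and>
    x $ 4 = y $ 4 \<and> x $ 5 = y $ 5 \<and> x $ 6 = y $ 6 \<and> x $ 7 = y $ 7"
  using assms all_less_8[of "\<lambda>i. x $ i = y $ i"] by (auto intro: eq_vecI)

text \<open>Rows 1 and 4 form a 2 by 2 system in the first velocity and the pressure component, with
  determinant \<open>v\<^sup>2 - c\<^sup>2 * metric_upper g 1 1\<close>. Once it is solved,
  \<open>v \<noteq> 0\<close> forces the remaining components to vanish.\<close>

lemma C1_unmagnetized_kernel:
  assumes x: "x \<in> carrier_vec 8"
    and 0: "C1 g \<mu> c (unmagnetized \<rho> P v) *\<^sub>v x = 0\<^sub>v 8"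
    and v: "v \<noteq> 0" "v\<^sup>2 \<noteq> c\<^sup>2 * metric_upper g 1 1" and \<rho>: "\<rho> \<noteq> 0"
  shows "x = 0\<^sub>v 8"
proof -
  \<comment> \<open>Over the reals the embedding is the identity, so the generic row formulas
    apply.\<close>
  have "map_mat of_real A = A" for A :: "real mat" by (rule eq_matI) auto
  then have 0: "map_mat of_real (C1 g \<mu> c (unmagnetized \<rho> P v)) *\<^sub>v x = 0\<^sub>v 8"
    using 0 by simp
  note eqs = C1_unmagnetized_mult[OF x refl, of g \<mu> c \<rho> P v, unfolded 0, simplified]
  have "\<rho> * v * x $ 1 + metric_upper g 1 1 * x $ 4 = 0"
    using eqs(3) \<rho> by (simp add: field_simps)
  moreover have "c\<^sup>2 * \<rho> * x $ 1 + v * x $ 4 = 0" using eqs(6) by simp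
  \<comment> \<open>This combination of the two rows eliminates \<open>x $ 1\<close>.\<close>
  moreover have "(v\<^sup>2 - c\<^sup>2 * metric_upper g 1 1) * x $ 4 =
      v * (c\<^sup>2 * \<rho> * x $ 1 + v * x $ 4) - c\<^sup>2 * (\<rho> * v * x $ 1 + metric_upper g 1 1 * x $ 4)"
    by (simp add: algebra_simps power2_eq_square)
  ultimately have "(v\<^sup>2 - c\<^sup>2 * metric_upper g 1 1) * x $ 4 = 0" by simp
  then have 4: "x $ 4 = 0" using v by simp
  then show ?thesis using eqs v \<rho> by (simp add: eq_vec_8_iff[OF x zero_carrier_vec])
qed

lemma invertible_C1_unmagnetized:
  assumes "v \<noteq> 0" "v\<^sup>2 \<noteq> c\<^sup>2 * metric_upper g 1 1" "\<rho> \<noteq> 0"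
  shows "invertible_mat (C1 g \<mu> c (unmagnetized \<rho> P v))"
  using invertible_mat_kernel[OF C1_carrier C1_unmagnetized_kernel[OF _ _ assms]] .

text \<open>
  Besides \<open>\<kappa> = 0\<close>, the eigenvalues are the roots of the characteristic equation
  \<open>\<kappa>\<^sup>2 (v\<^sup>1)\<^sup>2 = c\<^sup>2 (g\<^sup>2\<^sup>2 - 2 \<kappa> g\<^sup>1\<^sup>2 + \<kappa>\<^sup>2 g\<^sup>1\<^sup>1)\<close> of the acoustic waves.
\<close>

lemma spectrum_Cbar_unmagnetized:
  assumes g: "surface_metric g"
    and v: "v \<noteq> 0" "v\<^sup>2 \<noteq> c\<^sup>2 * metric_upper g 1 1" and \<rho>: "\<rho> \<noteq> 0" and c: "c \<noteq> 0"
    and \<kappa>: "\<kappa> \<noteq> 0"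
  shows "\<kappa> \<in> spectrum (map_mat complex_of_real (Cbar g \<mu> c (unmagnetized \<rho> P v))) \<longleftrightarrow>
    of_real (v\<^sup>2 - c\<^sup>2 * metric_upper g 1 1) * \<kappa>\<^sup>2 + 2 * of_real (c\<^sup>2 * metric_upper g 1 2) * \<kappa>
      - of_real (c\<^sup>2 * metric_upper g 2 2) = 0" (is "_ \<longleftrightarrow> ?quad = 0")
proof -
  define G11 where "G11 = complex_of_real (metric_upper g 1 1)"
  define G12 where "G12 = complex_of_real (metric_upper g 1 2)"
  define G22 where "G22 = complex_of_real (metric_upper g 2 2)"
  define V where "V = complex_of_real v"
  define R where "R = complex_of_real \<rho>"
  define K where "K = complex_of_real c"
  have nz: "V \<noteq> 0" "R \<noteq> 0" "K \<noteq> 0" using v \<rho> c by (auto simp: V_def R_def K_def)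
  have sym: "metric_upper g 2 1 = metric_upper g 1 2"
    using surface_metric_entries(1)[OF surface_metric_inverse[OF g]]
    by (simp add: metric_upper_def)
  have quad: "?quad = (V\<^sup>2 - K\<^sup>2 * G11) * \<kappa>\<^sup>2 + 2 * (K\<^sup>2 * G12) * \<kappa> - K\<^sup>2 * G22"
    by (simp add: V_def K_def G11_def G12_def G22_def)
  let ?A = "map_mat complex_of_real (C1 g \<mu> c (unmagnetized \<rho> P v))"
  let ?B = "map_mat complex_of_real (C2 g \<mu> c (unmagnetized \<rho> P v))"
  \<comment> \<open>Rows 3, 5, 6 and 7 of \<open>C2\<close> vanish and those of \<open>C1\<close>
    are diagonal, so \<kappa> and \<open>v\<close> being nonzero make these components zero.\<close>
  have pencil: "?B *\<^sub>v x = \<kappa> \<cdot>\<^sub>v (?A *\<^sub>v x) \<longleftrightarrow>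
      R * x $ 2 = \<kappa> * (V * x $ 0 + R * x $ 1) \<and>
      G12 / R * x $ 4 = \<kappa> * (V * x $ 1 + G11 / R * x $ 4) \<and>
      G22 / R * x $ 4 = \<kappa> * (V * x $ 2 + G12 / R * x $ 4) \<and>
      x $ 3 = 0 \<and>
      K\<^sup>2 * R * x $ 2 = \<kappa> * (K\<^sup>2 * R * x $ 1 + V * x $ 4) \<and>
      x $ 5 = 0 \<and> x $ 6 = 0 \<and> x $ 7 = 0"
    if x: "x \<in> carrier_vec 8" for x
  proof -
    note m1 = C1_unmagnetized_mult[OF x refl, of g \<mu> c \<rho> P v]
    note m2 = C2_unmagnetized_mult[OF x refl, of g \<mu> c \<rho> P v]
    have 1: "?B *\<^sub>v x \<in> carrier_vec 8" by (rule m2(1))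
    have 2: "\<kappa> \<cdot>\<^sub>v (?A *\<^sub>v x) \<in> carrier_vec 8" using m1(1) by simp
    have ix: "(\<kappa> \<cdot>\<^sub>v (?A *\<^sub>v x)) $ i = \<kappa> * (?A *\<^sub>v x) $ i" if "i < 8" for i
      using m1(1) that by (metis carrier_vecD index_smult_vec(1))
    show ?thesis
      unfolding eq_vec_8_iff[OF 1 2]
      using \<kappa> nz by (simp add: ix m1(2-9)[unfolded One_nat_def] m2(2-9)[unfolded One_nat_def]
          sym[unfolded One_nat_def] V_def R_def K_def G11_def G12_def G22_def del: index_mult_mat_vec)
  qed
  have "(\<exists>x \<in> carrier_vec 8. x \<noteq> 0\<^sub>v 8 \<and> ?B *\<^sub>v x = \<kappa> \<cdot>\<^sub>v (?A *\<^sub>v x)) \<longleftrightarrow> ?quad = 0"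
  proof
    assume "\<exists>x \<in> carrier_vec 8. x \<noteq> 0\<^sub>v 8 \<and> ?B *\<^sub>v x = \<kappa> \<cdot>\<^sub>v (?A *\<^sub>v x)"
    then obtain x where x: "x \<in> carrier_vec 8" "x \<noteq> 0\<^sub>v 8" "?B *\<^sub>v x = \<kappa> \<cdot>\<^sub>v (?A *\<^sub>v x)"
      by blast
    note eqs = x(3)[unfolded pencil[OF x(1)]]
    \<comment> \<open>Without a pressure component, rows 1 and 2 annihilate the velocity and row 0
      then the density.\<close>
    have x4: "x $ 4 \<noteq> 0"
    proof
      assume 4: "x $ 4 = 0"
      then have 12: "x $ 1 = 0" "x $ 2 = 0" using eqs \<kappa> nz by auto
      then have "x $ 0 = 0" using eqs \<kappa> nz by auto
      then show False using x(2) eqs 4 12 by (simp add: eq_vec_8_iff[OF x(1) zero_carrier_vec])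
    qed
    have e1: "\<kappa> * V * R * x $ 1 = (G12 - \<kappa> * G11) * x $ 4"
      and e2: "\<kappa> * V * R * x $ 2 = (G22 - \<kappa> * G12) * x $ 4"
      using eqs nz by (simp_all add: field_simps)
    have e4: "\<kappa> * V * x $ 4 = K\<^sup>2 * R * x $ 2 - \<kappa> * K\<^sup>2 * R * x $ 1"
      using eqs by (simp add: algebra_simps)
    \<comment> \<open>Row 4 is scaled by \<open>\<kappa> * V\<close>, and multiples of
      \<open>e1\<close> and \<open>e2\<close> are added so that \<open>x $ 1\<close> and
      \<open>x $ 2\<close> cancel.\<close>
    have "?quad * x $ 4 =
        \<kappa> * V * (\<kappa> * V * x $ 4 - (K\<^sup>2 * R * x $ 2 - \<kappa> * K\<^sup>2 * R * x $ 1)) +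
        K\<^sup>2 * (\<kappa> * V * R * x $ 2 - (G22 - \<kappa> * G12) * x $ 4) -
        \<kappa> * K\<^sup>2 * (\<kappa> * V * R * x $ 1 - (G12 - \<kappa> * G11) * x $ 4)"
      unfolding quad by (simp add: algebra_simps power2_eq_square)
    also have "\<dots> = 0" unfolding e1 e2 e4 by simp
    finally have "?quad * x $ 4 = 0" .
    then show "?quad = 0" using x4 by simp
  next
    assume q: "?quad = 0"
    \<comment> \<open>Taking \<open>\<kappa> * R * V\<close> as pressure component clears the
      denominators in rows 1 and 2. Comparing row 0 with row 4 then gives the density component as
      pressure over \<open>K\<^sup>2\<close>.\<close>
    define x where "x = vec_of_list
      [\<kappa> * R * V / K\<^sup>2, G12 - \<kappa> * G11, G22 - \<kappa> * G12, 0, \<kappa> * R * V, 0, 0, 0]"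
    have xc: "x \<in> carrier_vec 8" by (rule carrier_vecI) (simp add: x_def)
    have xi: "x $ 0 = \<kappa> * R * V / K\<^sup>2" "x $ 1 = G12 - \<kappa> * G11" "x $ 2 = G22 - \<kappa> * G12"
      "x $ 3 = 0" "x $ 4 = \<kappa> * R * V" "x $ 5 = 0" "x $ 6 = 0" "x $ 7 = 0"
      unfolding x_def vec_of_list_index by simp_all
    have "x \<noteq> 0\<^sub>v 8" using xi(5) \<kappa> nz by auto
    moreover have "?B *\<^sub>v x = \<kappa> \<cdot>\<^sub>v (?A *\<^sub>v x)"
    proof -
      \<comment> \<open>Only row 4 needs the quadratic: its residual is a multiple of it. Row 0 is
        row 4 divided by \<open>K\<^sup>2\<close>.\<close>
      have "K\<^sup>2 * R * (G22 - \<kappa> * G12) -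
          \<kappa> * (K\<^sup>2 * R * (G12 - \<kappa> * G11) + V * (\<kappa> * R * V)) = - R * ?quad"
        unfolding quad by (simp add: algebra_simps power2_eq_square)
      then have row4: "K\<^sup>2 * R * (G22 - \<kappa> * G12) =
          \<kappa> * (K\<^sup>2 * R * (G12 - \<kappa> * G11) + V * (\<kappa> * R * V))"
        unfolding q by simp
      have "\<kappa> * (V * (\<kappa> * R * V / K\<^sup>2) + R * (G12 - \<kappa> * G11)) =
          \<kappa> * (K\<^sup>2 * R * (G12 - \<kappa> * G11) + V * (\<kappa> * R * V)) / K\<^sup>2"
        using nz(3) by (simp add: field_simps)
      then have row0: "R * (G22 - \<kappa> * G12) =
          \<kappa> * (V * (\<kappa> * R * V / K\<^sup>2) + R * (G12 - \<kappa> * G11))"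
        unfolding row4[symmetric] using nz(3) by simp
      show ?thesis
        unfolding pencil[OF xc] xi using nz(2)
        by (intro conjI row0 row4) (simp_all add: field_simps)
    qed
    ultimately show "\<exists>x \<in> carrier_vec 8. x \<noteq> 0\<^sub>v 8 \<and> ?B *\<^sub>v x = \<kappa> \<cdot>\<^sub>v (?A *\<^sub>v x)"
      using xc by blast
  qed
  then show ?thesis
    unfolding Cbar_def
    using spectrum_pencil_iff[OF C1_carrier C2_carrier C1_unmagnetized_kernel[OF _ _ v \<rho>]]
    by simp
qed

section \<open>Real quadratics with complex roots\<close>

text \<open>The constant term is \<open>- d\<close>, so the quarter discriminant is
  \<open>b\<^sup>2 + a * d\<close>. Multiplying by \<open>a\<close> avoids division.\<close>

lemma quadratic_complete_square:
  fixes a :: "'a :: comm_ring_1"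
  shows "a * (a * x\<^sup>2 + 2 * b * x - d) = (a * x + b)\<^sup>2 - (b\<^sup>2 + a * d)"
  by (simp add: algebra_simps power2_eq_square)

text \<open>After completing the square, \<open>a * \<kappa> + b\<close> is a square root of a
  nonnegative real and hence real.\<close>

lemma real_quadratic_root_Reals:
  assumes "of_real a * \<kappa>\<^sup>2 + 2 * of_real b * \<kappa> - of_real d = (0 :: complex)"
    and "a \<noteq> 0" and "b\<^sup>2 + a * d \<ge> 0"
  shows "\<kappa> \<in> \<real>"
proof -
  have "(of_real a * \<kappa> + of_real b)\<^sup>2 = (of_real b)\<^sup>2 + of_real a * complex_of_real d"
    using quadratic_complete_square[of "of_real a" \<kappa> "of_real b" "of_real d"] assms(1) by simp
  also have "\<dots> = complex_of_real (b\<^sup>2 + a * d)" by simp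
  also have "\<dots> = (complex_of_real (sqrt (b\<^sup>2 + a * d)))\<^sup>2"
    using assms(3) by (metis of_real_power real_sqrt_pow2)
  finally have "of_real a * \<kappa> + of_real b \<in> \<real>"
    by (auto simp: power2_eq_iff)
  then have "of_real a * \<kappa> + of_real b - of_real b \<in> \<real>"
    by (rule Reals_diff) simp
  then have "(of_real a * \<kappa>) / of_real a \<in> \<real>" by (intro Reals_divide) simp_all
  then show ?thesis using assms(2) by simp
qed

lemma real_quadratic_nonreal_root:
  assumes "a \<noteq> 0" and "b\<^sup>2 + a * d < 0"
  obtains \<kappa> :: complex where
    "of_real a * \<kappa>\<^sup>2 + 2 * of_real b * \<kappa> - of_real d = 0" and "\<kappa> \<notin> \<real>"
proof -
  define s where "s = sqrt (- (b\<^sup>2 + a * d))"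
  have s: "s\<^sup>2 = - (b\<^sup>2 + a * d)" "s > 0" using assms(2) by (simp_all add: s_def)
  \<comment> \<open>Chosen as the solution of \<open>a * \<kappa> + b = \<i> * s\<close>, whose
    square is the negative quarter discriminant.\<close>
  define \<kappa> where "\<kappa> = Complex (- b / a) (s / a)"
  have "of_real a * \<kappa> + of_real b = \<i> * of_real s"
    using assms(1) by (simp add: \<kappa>_def complex_eq_iff)
  moreover have "(complex_of_real s)\<^sup>2 = - ((of_real b)\<^sup>2 + of_real a * of_real d)"
    using arg_cong[OF s(1), of complex_of_real] by simp
  ultimately have "of_real a * (of_real a * \<kappa>\<^sup>2 + 2 * of_real b * \<kappa> - of_real d) = 0"
    by (simp add: quadratic_complete_square power_mult_distrib)
  then have "of_real a * \<kappa>\<^sup>2 + 2 * of_real b * \<kappa> - of_real d = 0"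
    using assms(1) by simp
  moreover have "\<kappa> \<notin> \<real>" using s(2) assms(1) by (simp add: \<kappa>_def complex_is_Real_iff)
  ultimately show ?thesis by (rule that)
qed

theorem mainTheorem3:
  fixes p :: "real \<Rightarrow> real \<Rightarrow> real" and D :: "(real \<times> real) set"
    and \<mu> :: real and g :: "real mat"
  assumes "gas_law D p" and "\<mu> > 0" and "surface_metric g"
  shows "(\<exists>\<Phi> e. state_with_energy D p \<Phi> e \<and>
            invertible_mat (C1 g \<mu> (sound_speed p (density \<Phi>) e) \<Phi>) \<and>
            hyperbolic_type (Cbar g \<mu> (sound_speed p (density \<Phi>) e) \<Phi>)) \<and>
         (\<exists>\<Phi> e. state_with_energy D p \<Phi> e \<and>
            invertible_mat (C1 g \<mu> (sound_speed p (density \<Phi>) e) \<Phi>) \<and>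
            elliptic_type (Cbar g \<mu> (sound_speed p (density \<Phi>) e) \<Phi>))"
proof -
  \<comment> \<open>One admissible pair, hence one sound speed, serves both types; only the first
    surface velocity changes.\<close>
  obtain \<rho> e where De: "(\<rho>, e) \<in> D" and \<rho>: "\<rho> > 0" and c: "sound_speed p \<rho> e > 0"
    using assms(1) unfolding gas_law_def by fast
  define c where "c = sound_speed p \<rho> e"
  define a where "a = metric_upper g 1 1"
  define b where "b = metric_upper g 1 2"
  define d where "d = metric_upper g 2 2"
  have pos: "a > 0" "d > 0" "b\<^sup>2 < a * d" "c > 0"
    using surface_metric_entries[OF surface_metric_inverse[OF assms(3)]] c
    by (simp_all add: metric_upper_def a_def b_def d_def c_def)
  have dens: "density (unmagnetized \<rho> P v) = \<rho>" for P v by (simp add: unmagnetized_def)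
  have state: "state_with_energy D p (unmagnetized \<rho> (p \<rho> e) v) e" for v
    using De by (simp add: state_with_energy_def unmagnetized_def)
  have witness: "\<exists>\<Phi> e. state_with_energy D p \<Phi> e \<and>
      invertible_mat (C1 g \<mu> (sound_speed p (density \<Phi>) e) \<Phi>) \<and>
      T (Cbar g \<mu> (sound_speed p (density \<Phi>) e) \<Phi>)"
    if "invertible_mat (C1 g \<mu> c (unmagnetized \<rho> (p \<rho> e) v))"
      "T (Cbar g \<mu> c (unmagnetized \<rho> (p \<rho> e) v))" for v T
    by (rule exI[of _ "unmagnetized \<rho> (p \<rho> e) v"], rule exI[of _ e],
        unfold dens, fold c_def) (intro conjI state that)
  note spec = spectrum_Cbar_unmagnetized[OF assms(3), where c = c and \<rho> = \<rho>,
      folded a_def b_def d_def]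
  note inv = invertible_C1_unmagnetized[where g = g and c = c and \<rho> = \<rho>, folded a_def]
  \<comment> \<open>The factor 2 makes the leading coefficient
    \<open>v1\<^sup>2 - c\<^sup>2 * a\<close> equal to \<open>c\<^sup>2 * a > 0\<close>, so both
    summands of the quarter discriminant are nonnegative.\<close>
  define v1 where "v1 = c * sqrt (2 * a)"
  have v1: "v1\<^sup>2 = 2 * c\<^sup>2 * a" "v1 \<noteq> 0" "v1\<^sup>2 \<noteq> c\<^sup>2 * a"
    using pos by (auto simp: v1_def power_mult_distrib)
  have "hyperbolic_type (Cbar g \<mu> c (unmagnetized \<rho> (p \<rho> e) v1))"
    unfolding hyperbolic_type_def
  proof
    fix \<kappa>
    assume \<kappa>: "\<kappa> \<in> spectrum (map_mat complex_of_real (Cbar g \<mu> c (unmagnetized \<rho> (p \<rho> e) v1)))"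
    show "\<kappa> \<in> \<real>"
    \<comment> \<open>The quadratic criterion covers only nonzero \<kappa>; zero is real
      anyway.\<close>
    proof (cases "\<kappa> = 0")
      case False
      have "(c\<^sup>2 * b)\<^sup>2 + (v1\<^sup>2 - c\<^sup>2 * a) * (c\<^sup>2 * d) \<ge> 0"
        using v1(1) pos by simp
      moreover have "v1\<^sup>2 - c\<^sup>2 * a \<noteq> 0" using v1 by simp
      ultimately show ?thesis
        using real_quadratic_root_Reals spec[OF v1(2,3) _ _ False] \<kappa> \<rho> pos by blast
    qed simp
  qed
  moreover have "invertible_mat (C1 g \<mu> c (unmagnetized \<rho> (p \<rho> e) v1))"
    using inv[OF v1(2,3)] \<rho> by simp
  \<comment> \<open>The quarter discriminant is negative exactly when the squared speed lies below
    \<open>c\<^sup>2 * (a * d - b\<^sup>2) / d\<close>. Half of this threshold is taken; it is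
    positive because the metric is definite.\<close>
  moreover define v2 where "v2 = c * sqrt ((a * d - b\<^sup>2) / (2 * d))"
  have v2: "v2\<^sup>2 = c\<^sup>2 * ((a * d - b\<^sup>2) / (2 * d))" "v2 \<noteq> 0"
    using pos by (auto simp: v2_def power_mult_distrib)
  \<comment> \<open>This keeps \<open>v2\<^sup>2\<close> below \<open>c\<^sup>2 * a\<close>, so that
    \<open>C1\<close> is invertible and the quadratic does not degenerate.\<close>
  have "(a * d - b\<^sup>2) / (2 * d) < a"
    using pos by (simp add: field_simps) (smt (verit) zero_le_power2 mult_pos_pos)
  then have v2': "v2\<^sup>2 < c\<^sup>2 * a"
    unfolding v2(1) using pos(4) by (intro mult_strict_left_mono) simp_all
  have disc: "(c\<^sup>2 * b)\<^sup>2 + (v2\<^sup>2 - c\<^sup>2 * a) * (c\<^sup>2 * d) < 0"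
  proof -
    have "(c\<^sup>2 * b)\<^sup>2 + (v2\<^sup>2 - c\<^sup>2 * a) * (c\<^sup>2 * d) = - ((c\<^sup>2)\<^sup>2 * (a * d - b\<^sup>2) / 2)"
      unfolding v2(1) using pos by (simp add: field_simps power2_eq_square)
    also have "\<dots> < 0" using pos by simp
    finally show ?thesis .
  qed
  have "elliptic_type (Cbar g \<mu> c (unmagnetized \<rho> (p \<rho> e) v2))"
  proof -
    have "v2\<^sup>2 - c\<^sup>2 * a \<noteq> 0" using v2' by simp
    then obtain \<kappa> :: complex where \<kappa>: "of_real (v2\<^sup>2 - c\<^sup>2 * a) * \<kappa>\<^sup>2 + 2 * of_real (c\<^sup>2 * b) * \<kappa>
        - of_real (c\<^sup>2 * d) = 0" "\<kappa> \<notin> \<real>"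
      using disc by (rule real_quadratic_nonreal_root)
    have "\<kappa> \<noteq> 0" using \<kappa>(2) by auto
    then have "\<kappa> \<in> spectrum (map_mat complex_of_real (Cbar g \<mu> c (unmagnetized \<rho> (p \<rho> e) v2)))"
      using spec[OF v2(2) less_imp_neq[OF v2']] \<kappa>(1) \<rho> pos(4) by blast
    then show ?thesis unfolding elliptic_type_def using \<kappa>(2) by blast
  qed
  moreover have "invertible_mat (C1 g \<mu> c (unmagnetized \<rho> (p \<rho> e) v2))"
    using inv[OF v2(2)] v2' \<rho> by simp
  ultimately show ?thesis by (intro conjI witness)
qed

end
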